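(* Let $\Omega=S^1$ and suppose that $\mathbb{P}$ has full support, where $\sigma$ is an invertible ergodic measure-preserving transformation of the probability space $(\Omega,\mathfrak{F},\mathbb{P})$. Then stability is prevalent in $$\mathcal{E}=\left\{\mathcal{T}_{\zeta}\in\mathcal{B} \ \big|\ \zeta\in C^1(\Omega,\{0\}\times D_1)\right\},$$ where $\mathcal{B}$ is the space of monic quadratic Blaschke product cocycles over $\sigma$ fixing the origin; that is, the set of stable cocycles in $\mathcal{E}$ is prevalent in $\mathcal{E}$.
   Context: $D_1=\{z\in\mathbb{C}:|z|<1\}$ and $S^1$ is the unit circle; $C^1$ means continuously differentiable in the real sense. Cocycles: for a measurable function $\zeta_2:\Omega\to D_1$ (written $\omega\mapsto\zeta_{2,\omega}$) and $\zeta=(0,\zeta_2)$, the monic quadratic Blaschke product cocycle fixing the origin $\mathcal{T}_\zeta=(T_\omega)_{\omega\in\Omega}$ over $\sigma$ is given by $T_\omega(z)=z\,\frac{z-\zeta_{2,\omega}}{1-\overline{\zeta_{2,\omega}}\,z}$. $\mathcal{B}$ denotes the space of all such cocycles. The random fixed point of $\mathcal{T}_\zeta$ is $x_\omega=0$. Stability: $\mathcal{T}_\zeta$ is stable if $\operatorname{ess\,inf}_{\omega\in\Omega}|T_\omega'(x_\omega)|>0$ and unstable if $\operatorname{ess\,inf}_{\omega\in\Omega}|T_\omega'(x_\omega)|=0$ (essential infimum with respect to $\mathbb{P}$, with $x_\omega=0$). Linear structure and metric: let $\Phi:D_1\to\mathbb{C}$, $\Phi(z)=z/\sqrt{1-|z|^2}$,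 a diffeomorphism with inverse $\Phi^{-1}(z)=z/\sqrt{1+|z|^2}$. For $\xi=(0,\xi_2)$, $\chi=(0,\chi_2)$ and $\alpha\in\mathbb{C}$, put $\mathcal{T}_\xi+\mathcal{T}_\chi:=\mathcal{T}_{(0,\Phi^{-1}(\Phi(\xi_2)+\Phi(\chi_2)))}$ and $\alpha\cdot\mathcal{T}_\xi:=\mathcal{T}_{(0,\Phi^{-1}(\alpha\Phi(\xi_2)))}$. The space $\mathcal{B}$ is equipped with these operations and the metric $d(\mathcal{T}_\xi,\mathcal{T}_\chi)=\operatorname{ess\,sup}_{\omega\in\Omega}|\Phi(\xi_{2,\omega})-\Phi(\chi_{2,\omega})|$, and $\mathcal{E}$ is regarded as a subspace of it. Prevalence: let $E$ be a completely metrisable topological vector space. A Borel set $U\subset E$ is prevalent if there exists a Borel measure $\mu$ on $E$ such that (a) $0<\mu(V)<\infty$ for some compact subset $V$ of $E$; and (b) the set $U+x$ has full $\mu$-measure for all $x\in E$. A general subset $S\subset E$ is prevalent if it contains a prevalent Borel set.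
   Formalization: Prevalence is defined here for metrisable rather than completely metrisable topological vector spaces, since E with the ess-sup metric is a proper dense subspace of C(S^1,C) via Phi and hence not completely metrisable. *)

theory Defs
  imports "HOL-Probability.Probability"
begin

section \<open>The base dynamics\<close>

definition invertible_ergodic_mpt :: "'a measure \<Rightarrow> ('a \<Rightarrow> 'a) \<Rightarrow> bool" where
  "invertible_ergodic_mpt M s \<longleftrightarrow>
     prob_space M \<and>
     bij_betw s (space M) (space M) \<and>
     s \<in> M \<rightarrow>\<^sub>M M \<and> inv_into (space M) s \<in> M \<rightarrow>\<^sub>M M \<and>
     distr M M s = M \<and>
     (\<forall>A\<in>sets M. s -` A \<inter> space M = A \<longrightarrow> measure M A = 0 \<or> measure M A = 1)"

definition full_support :: "'a::topological_space measure \<Rightarrow> bool" where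
  "full_support M \<longleftrightarrow>
     (\<forall>U. openin (top_of_set (space M)) U \<and> U \<noteq> {} \<longrightarrow> emeasure M U > 0)"


section \<open>Quadratic Blaschke product cocycles fixing the origin\<close>

definition blaschke :: "complex \<Rightarrow> complex \<Rightarrow> complex" where
  "blaschke a z = z * ((z - a) / (1 - cnj a * z))"

text \<open>The admissible second zeros. The first zero is identically 0 and is not recorded.
  Parameters and cocycles are extensional, so that functions on \<open>space M\<close> that agree there
  are equal; functions that agree only almost everywhere are not identified.\<close>

definition params :: "'a measure \<Rightarrow> ('a \<Rightarrow> complex) set" where
  "params M = {\<zeta>. \<zeta> \<in> space M \<rightarrow>\<^sub>E ball 0 1 \<and> \<zeta> \<in> borel_measurable M}"

definition cocycle :: "'a measure \<Rightarrow> ('a \<Rightarrow> complex) \<Rightarrow> 'a \<Rightarrow> complex \<Rightarrow> complex" where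
  "cocycle M \<zeta> = (\<lambda>\<omega>\<in>space M. blaschke (\<zeta> \<omega>))"

definition cocycles :: "'a measure \<Rightarrow> ('a \<Rightarrow> complex \<Rightarrow> complex) set" where
  "cocycles M = cocycle M ` params M"

text \<open>The parameter of a cocycle, well defined by \<open>inj_on_cocycle\<close> below.\<close>

definition zeta :: "'a measure \<Rightarrow> ('a \<Rightarrow> complex \<Rightarrow> complex) \<Rightarrow> 'a \<Rightarrow> complex" where
  "zeta M = inv_into (params M) (cocycle M)"

lemma deriv_blaschke_0: "deriv (blaschke a) 0 = - a"
proof -
  have "(blaschke a has_field_derivative - a) (at 0)"
    unfolding blaschke_def by (auto intro!: derivative_eq_intros)
  then show ?thesis by (rule DERIV_imp_deriv)
qed

lemma inj_on_cocycle: "inj_on (cocycle M) (params M)"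
proof (rule inj_onI)
  fix \<xi> \<eta> assume *: "\<xi> \<in> params M" "\<eta> \<in> params M" "cocycle M \<xi> = cocycle M \<eta>"
  show "\<xi> = \<eta>"
  proof (rule extensionalityI[of _ "space M"])
    show "\<xi> \<in> extensional (space M)" "\<eta> \<in> extensional (space M)"
      using * by (auto simp: params_def PiE_def)
    fix \<omega> assume "\<omega> \<in> space M"
    then have "blaschke (\<xi> \<omega>) = blaschke (\<eta> \<omega>)"
      using fun_cong[OF *(3), of \<omega>] by (simp add: cocycle_def)
    then show "\<xi> \<omega> = \<eta> \<omega>"
      by (metis deriv_blaschke_0 neg_equal_iff_equal)
  qed
qed

lemma zeta_cocycle: "\<zeta> \<in> params M \<Longrightarrow> zeta M (cocycle M \<zeta>) = \<zeta>"
  unfolding zeta_def by (rule inv_into_f_f[OF inj_on_cocycle])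

text \<open>Stability, with respect to the random fixed point \<open>x\<^sub>\<omega> = 0\<close>.\<close>

definition essinf :: "'a measure \<Rightarrow> ('a \<Rightarrow> ereal) \<Rightarrow> ereal" where
  "essinf M f = - esssup M (\<lambda>x. - f x)"

definition stable_cocycle :: "'a measure \<Rightarrow> ('a \<Rightarrow> complex \<Rightarrow> complex) \<Rightarrow> bool" where
  "stable_cocycle M T \<longleftrightarrow> essinf M (\<lambda>\<omega>. ereal (cmod (deriv (T \<omega>) 0))) > 0"


section \<open>Linear structure and metric\<close>

definition Phi :: "complex \<Rightarrow> complex" where
  "Phi z = z / complex_of_real (sqrt (1 - (cmod z)\<^sup>2))"

definition Phi_inv :: "complex \<Rightarrow> complex" where
  "Phi_inv z = z / complex_of_real (sqrt (1 + (cmod z)\<^sup>2))"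

definition cocycle_add ::
  "'a measure \<Rightarrow> ('a \<Rightarrow> complex \<Rightarrow> complex) \<Rightarrow> ('a \<Rightarrow> complex \<Rightarrow> complex) \<Rightarrow> 'a \<Rightarrow> complex \<Rightarrow> complex"
  where "cocycle_add M S T = cocycle M (\<lambda>\<omega>. Phi_inv (Phi (zeta M S \<omega>) + Phi (zeta M T \<omega>)))"

definition cocycle_scale ::
  "'a measure \<Rightarrow> complex \<Rightarrow> ('a \<Rightarrow> complex \<Rightarrow> complex) \<Rightarrow> 'a \<Rightarrow> complex \<Rightarrow> complex"
  where "cocycle_scale M \<alpha> T = cocycle M (\<lambda>\<omega>. Phi_inv (\<alpha> * Phi (zeta M T \<omega>)))"

text \<open>On all of \<open>cocycles M\<close> the distance may be infinite, hence the extended reals.\<close>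

definition cocycle_dist ::
  "'a measure \<Rightarrow> ('a \<Rightarrow> complex \<Rightarrow> complex) \<Rightarrow> ('a \<Rightarrow> complex \<Rightarrow> complex) \<Rightarrow> ereal" where
  "cocycle_dist M S T = esssup M (\<lambda>\<omega>. ereal (cmod (Phi (zeta M S \<omega>) - Phi (zeta M T \<omega>))))"

definition cocycle_topology :: "'a measure \<Rightarrow> ('a \<Rightarrow> complex \<Rightarrow> complex) topology" where
  "cocycle_topology M = topology (\<lambda>U. U \<subseteq> cocycles M \<and>
     (\<forall>S\<in>U. \<exists>e>0. \<forall>T\<in>cocycles M. cocycle_dist M S T < ereal e \<longrightarrow> T \<in> U))"

lemma openin_cocycle_topology:
  "openin (cocycle_topology M) U \<longleftrightarrow> U \<subseteq> cocycles M \<and>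
     (\<forall>S\<in>U. \<exists>e>0. \<forall>T\<in>cocycles M. cocycle_dist M S T < ereal e \<longrightarrow> T \<in> U)"
proof -
  have "istopology (\<lambda>U. U \<subseteq> cocycles M \<and>
     (\<forall>S\<in>U. \<exists>e>0. \<forall>T\<in>cocycles M. cocycle_dist M S T < ereal e \<longrightarrow> T \<in> U))"
    (is "istopology ?P")
    unfolding istopology_def
  proof (intro conjI allI impI)
    fix U V assume U: "?P U" and V: "?P V"
    show "U \<inter> V \<subseteq> cocycles M" using U by auto
    show "\<forall>S\<in>U \<inter> V. \<exists>e>0. \<forall>T\<in>cocycles M. cocycle_dist M S T < ereal e \<longrightarrow> T \<in> U \<inter> V"
    proof
      fix S assume S: "S \<in> U \<inter> V"
      obtain d where d: "d > 0" "\<forall>T\<in>cocycles M. cocycle_dist M S T < ereal d \<longrightarrow> T \<in> U"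
        using U S by blast
      obtain e where e: "e > 0" "\<forall>T\<in>cocycles M. cocycle_dist M S T < ereal e \<longrightarrow> T \<in> V"
        using V S by blast
      have "cocycle_dist M S T < ereal (min d e) \<Longrightarrow>
          cocycle_dist M S T < ereal d \<and> cocycle_dist M S T < ereal e" for T
        by (metis ereal_less_eq(3) less_le_trans min.cobounded1 min.cobounded2)
      then show "\<exists>e>0. \<forall>T\<in>cocycles M. cocycle_dist M S T < ereal e \<longrightarrow> T \<in> U \<inter> V"
        using d e by (intro exI[of _ "min d e"]) auto
    qed
  next
    fix K assume "\<forall>U\<in>K. ?P U"
    then show "\<Union>K \<subseteq> cocycles M"
      and "\<forall>S\<in>\<Union>K. \<exists>e>0. \<forall>T\<in>cocycles M. cocycle_dist M S T < ereal e \<longrightarrow> T \<in> \<Union>K"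
      by (blast, meson UnionE UnionI)
  qed
  then show ?thesis
    unfolding cocycle_topology_def by simp
qed

lemma topspace_cocycle_topology: "topspace (cocycle_topology M) = cocycles M"
proof -
  have "openin (cocycle_topology M) (cocycles M)"
    unfolding openin_cocycle_topology using zero_less_one by blast
  then show ?thesis
    by (meson openin_cocycle_topology openin_subset openin_topspace subset_antisym)
qed


section \<open>Continuously differentiable cocycles over the circle\<close>

text \<open>\<open>C\<^sup>1\<close> on the circle is expressed in the angular coordinate \<open>t \<mapsto> e\<^sup>i\<^sup>t\<close>, a local
  diffeomorphism from the line onto the circle.\<close>

definition C1_cocycles :: "complex measure \<Rightarrow> (complex \<Rightarrow> complex \<Rightarrow> complex) set" where
  "C1_cocycles M =
     cocycle M ` {\<zeta> \<in> params M. (\<lambda>t. \<zeta> (cis t)) C1_differentiable_on UNIV}"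


section \<open>Prevalence\<close>

locale metrizable_tvs =
  fixes X :: "'v topology"
    and add :: "'v \<Rightarrow> 'v \<Rightarrow> 'v"
    and scal :: "complex \<Rightarrow> 'v \<Rightarrow> 'v"
  assumes metrizable: "metrizable_space X"
    and continuous_add: "continuous_map (prod_topology X X) X (\<lambda>(x, y). add x y)"
    and continuous_scale: "continuous_map (prod_topology euclidean X) X (\<lambda>(a, x). scal a x)"
    and add_assoc: "\<lbrakk>x \<in> topspace X; y \<in> topspace X; z \<in> topspace X\<rbrakk>
           \<Longrightarrow> add (add x y) z = add x (add y z)"
    and add_commute: "\<lbrakk>x \<in> topspace X; y \<in> topspace X\<rbrakk> \<Longrightarrow> add x y = add y x"
    and zero_and_inverse: "\<exists>z\<in>topspace X. \<forall>x\<in>topspace X.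
           add x z = x \<and> (\<exists>y\<in>topspace X. add x y = z)"
    and scale_add_right: "\<lbrakk>x \<in> topspace X; y \<in> topspace X\<rbrakk>
           \<Longrightarrow> scal a (add x y) = add (scal a x) (scal a y)"
    and scale_add_left: "x \<in> topspace X \<Longrightarrow> scal (a + b) x = add (scal a x) (scal b x)"
    and scale_scale: "x \<in> topspace X \<Longrightarrow> scal a (scal b x) = scal (a * b) x"
    and scale_one: "x \<in> topspace X \<Longrightarrow> scal 1 x = x"

definition borel_of :: "'v topology \<Rightarrow> 'v measure" where
  "borel_of X = sigma (topspace X) {U. openin X U}"

definition prevalent_borel :: "'v topology \<Rightarrow> ('v \<Rightarrow> 'v \<Rightarrow> 'v) \<Rightarrow> 'v set \<Rightarrow> bool" where
  "prevalent_borel X add U \<longleftrightarrow>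
     U \<in> sets (borel_of X) \<and>
     (\<exists>\<mu>. sets \<mu> = sets (borel_of X) \<and>
        (\<exists>V. compactin X V \<and> 0 < emeasure \<mu> V \<and> emeasure \<mu> V < \<infinity>) \<and>
        (\<forall>x\<in>topspace X. topspace X - (\<lambda>u. add u x) ` U \<in> null_sets \<mu>))"

text \<open>Only metrizability of the ambient space is required, not complete metrizability:
  with the essential supremum metric, the space of \<open>C\<^sup>1\<close> cocycles is not complete.\<close>

definition prevalent ::
  "'v topology \<Rightarrow> ('v \<Rightarrow> 'v \<Rightarrow> 'v) \<Rightarrow> (complex \<Rightarrow> 'v \<Rightarrow> 'v) \<Rightarrow> 'v set \<Rightarrow> bool" where
  "prevalent X add scal S \<longleftrightarrow>
     metrizable_tvs X add scal \<and> S \<subseteq> topspace X \<and> (\<exists>U\<subseteq>S. prevalent_borel X add U)"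

end

(* In the coordinate Phi (zeta T), a C1 cocycle is a C1 function on the circle, and by full support
   the essential supremum metric is the sup metric there, so the space of C1 cocycles embeds
   isometrically into the bounded continuous functions. A cocycle whose coordinate has no zero is
   stable by compactness. Let the measure be Lebesgue measure on the complex line of constant
   functions. The constant c fails to lie in the translate by S of the zero-free cocycles iff c is
   a value of the coordinate of S; these values form a C1 curve, a null set in the plane. *)

theory Submission
  imports Defs
begin

section \<open>The coordinate map \<open>Phi\<close> and its inverse\<close>

lemma Phi_inv_in_ball: "cmod (Phi_inv z) < 1"
proof -
  have "cmod z < sqrt (1 + (cmod z)\<^sup>2)"
    by (rule real_less_rsqrt) simp
  moreover have "0 < sqrt (1 + (cmod z)\<^sup>2)"
    by (simp add: add_pos_nonneg)
  ultimately show ?thesis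
    by (simp add: Phi_inv_def norm_divide)
qed

lemma Phi_Phi_inv: "Phi (Phi_inv z) = z"
proof -
  define s where "s = sqrt (1 + (cmod z)\<^sup>2)"
  have s: "s > 0" "s\<^sup>2 = 1 + (cmod z)\<^sup>2"
    by (auto simp: s_def add_pos_nonneg)
  \<comment> \<open>The modulus of \<open>Phi_inv z\<close> is \<open>cmod z / s\<close>, so the
    denominator of \<open>Phi\<close> at that point is \<open>1 / s\<close>, which undoes the
    division by \<open>s\<close>.\<close>
  have "1 - (cmod z / s)\<^sup>2 = (1 / s)\<^sup>2"
    using s by (simp add: power_divide divide_simps add_nonneg_eq_0_iff)
  then have "sqrt (1 - (cmod z / s)\<^sup>2) = 1 / s"
    using s(1) by (simp add: real_sqrt_unique)
  then show ?thesis
    using s(1) by (simp add: Phi_def Phi_inv_def flip: s_def) (simp add: norm_divide)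
qed

lemma Phi_inv_Phi:
  assumes "cmod z < 1"
  shows "Phi_inv (Phi z) = z"
proof -
  define s where "s = sqrt (1 - (cmod z)\<^sup>2)"
  have "(cmod z)\<^sup>2 < 1"
    using assms by (simp add: abs_square_less_1)
  then have s: "s > 0" "s\<^sup>2 = 1 - (cmod z)\<^sup>2"
    by (auto simp: s_def)
  have "1 + (cmod z / s)\<^sup>2 = (1 / s)\<^sup>2"
    using s by (simp add: power_divide field_simps)
  then have "sqrt (1 + (cmod z / s)\<^sup>2) = 1 / s"
    using s(1) by (simp add: real_sqrt_unique)
  then show ?thesis
    using s(1) by (simp add: Phi_def Phi_inv_def flip: s_def) (simp add: norm_divide)
qed

lemma continuous_on_Phi_inv [continuous_intros]:
  "continuous_on A f \<Longrightarrow> continuous_on A (\<lambda>x. Phi_inv (f x))"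
proof -
  have "sqrt (1 + (cmod z)\<^sup>2) \<noteq> 0" for z
    by (metis add_pos_nonneg less_irrefl real_sqrt_eq_zero_cancel_iff zero_le_power2 zero_less_one)
  then show "continuous_on A f \<Longrightarrow> continuous_on A (\<lambda>x. Phi_inv (f x))"
    unfolding Phi_inv_def by (intro continuous_intros) auto
qed

text \<open>The formula is Borel on the whole plane, also where the square root has a nonpositive
  argument, so \<open>Phi\<close> can be composed with the parameter of any cocycle.\<close>

lemma borel_measurable_Phi [measurable]: "Phi \<in> borel_measurable borel"
  unfolding Phi_def by measurable

section \<open>Continuous differentiability of \<open>Phi\<close> and \<open>Phi_inv\<close> along
  curves\<close>

text \<open>Chain rule with hypotheses on \<open>\<phi>\<close> only along the range of
  \<open>r\<close>, because \<open>\<phi>\<close> will be an inverse square root. The result is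
  complex valued so that it can be multiplied with a complex curve.\<close>

lemma C1_differentiable_on_of_real_comp:
  fixes r \<phi> \<phi>' :: "real \<Rightarrow> real"
  assumes r: "r C1_differentiable_on UNIV"
    and deriv: "\<And>t. (\<phi> has_real_derivative \<phi>' (r t)) (at (r t))"
    and cont: "continuous_on (range r) \<phi>'"
  shows "(\<lambda>t. complex_of_real (\<phi> (r t))) C1_differentiable_on UNIV"
proof -
  obtain D where D: "\<And>t. (r has_vector_derivative D t) (at t)" "continuous_on UNIV D"
    using r by (auto simp: C1_differentiable_on_def)
  have r_cont: "continuous_on UNIV r"
    using D(1) by (meson continuous_at_imp_continuous_on has_vector_derivative_continuous)
  have "((\<lambda>t. complex_of_real (\<phi> (r t))) has_vector_derivative
      complex_of_real (\<phi>' (r t) * D t)) (at t)" for t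
  proof -
    have "(r has_real_derivative D t) (at t)"
      using D(1) by (simp add: has_real_derivative_iff_has_vector_derivative)
    from DERIV_chain2[OF deriv this] show ?thesis
      by (intro has_vector_derivative_of_real)
         (simp add: has_real_derivative_iff_has_vector_derivative)
  qed
  moreover have "continuous_on UNIV (\<lambda>t. complex_of_real (\<phi>' (r t) * D t))"
    by (intro continuous_intros D(2) continuous_on_compose2[OF cont r_cont]) auto
  ultimately show ?thesis
    unfolding C1_differentiable_on_def
    by (intro exI[of _ "\<lambda>t. complex_of_real (\<phi>' (r t) * D t)"]) auto
qed

text \<open>The square of the norm is the inner product of \<open>h t\<close> with itself, hence
  smooth even where \<open>h\<close> vanishes and the norm itself may fail to be
  differentiable.\<close>

lemma C1_differentiable_on_norm_power2:
  fixes h :: "real \<Rightarrow> complex"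
  assumes "h C1_differentiable_on UNIV"
  shows "(\<lambda>t. (cmod (h t))\<^sup>2) C1_differentiable_on UNIV"
proof -
  obtain D where D: "\<And>t. (h has_vector_derivative D t) (at t)" "continuous_on UNIV D"
    using assms by (auto simp: C1_differentiable_on_def)
  have h_cont: "continuous_on UNIV h"
    using D(1) by (meson continuous_at_imp_continuous_on has_vector_derivative_continuous)
  have "((\<lambda>t. h t \<bullet> h t) has_vector_derivative (h t \<bullet> D t + D t \<bullet> h t)) (at t)" for t
    by (rule bounded_bilinear.has_vector_derivative[OF bounded_bilinear_inner D(1) D(1)])
  then have "((\<lambda>t. (cmod (h t))\<^sup>2) has_vector_derivative (h t \<bullet> D t + D t \<bullet> h t)) (at t)" for t
    by (simp add: power2_norm_eq_inner)
  moreover have "continuous_on UNIV (\<lambda>t. h t \<bullet> D t + D t \<bullet> h t)"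
    by (intro continuous_intros h_cont D(2))
  ultimately show ?thesis
    unfolding C1_differentiable_on_def
    by (intro exI[of _ "\<lambda>t. h t \<bullet> D t + D t \<bullet> h t"]) auto
qed

lemma has_real_derivative_inverse_sqrt:
  assumes "0 < 1 + c * s"
  shows "((\<lambda>s. inverse (sqrt (1 + c * s))) has_real_derivative
          - c * inverse (sqrt (1 + c * s)) ^ 3 / 2) (at s)"
proof -
  have "((\<lambda>s. inverse (sqrt (1 + c * s))) has_real_derivative
          - (inverse (sqrt (1 + c * s)) * (c * (inverse (sqrt (1 + c * s)) / 2)) *
             inverse (sqrt (1 + c * s)))) (at s)"
    using assms by (auto intro!: derivative_eq_intros)
  then show ?thesis
    by (rule DERIV_cong) (simp add: power3_eq_cube)
qed

text \<open>Treats both coordinate maps at once: \<open>c = -1\<close> gives \<open>Phi\<close> and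
  \<open>c = 1\<close> gives \<open>Phi_inv\<close>.\<close>

lemma C1_differentiable_on_mult_inverse_sqrt:
  fixes h :: "real \<Rightarrow> complex"
  assumes h: "h C1_differentiable_on UNIV" and pos: "\<And>t. 0 < 1 + c * (cmod (h t))\<^sup>2"
  shows "(\<lambda>t. h t / complex_of_real (sqrt (1 + c * (cmod (h t))\<^sup>2))) C1_differentiable_on UNIV"
proof -
  have "(\<lambda>t. complex_of_real (inverse (sqrt (1 + c * (cmod (h t))\<^sup>2)))) C1_differentiable_on UNIV"
    using pos less_imp_neq[OF pos]
    by (intro C1_differentiable_on_of_real_comp[OF C1_differentiable_on_norm_power2[OF h],
          where \<phi>' = "\<lambda>s. - c * inverse (sqrt (1 + c * s)) ^ 3 / 2"]
        has_real_derivative_inverse_sqrt continuous_intros) auto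
  from C1_differentiable_on_mult[OF h this] show ?thesis
    by (simp add: divide_inverse)
qed

lemma C1_differentiable_on_Phi:
  fixes h :: "real \<Rightarrow> complex"
  assumes "h C1_differentiable_on UNIV" "\<And>t. cmod (h t) < 1"
  shows "(\<lambda>t. Phi (h t)) C1_differentiable_on UNIV"
  using C1_differentiable_on_mult_inverse_sqrt[of h "-1"] assms
  by (simp add: Phi_def abs_square_less_1)

lemma C1_differentiable_on_Phi_inv:
  fixes h :: "real \<Rightarrow> complex"
  assumes "h C1_differentiable_on UNIV"
  shows "(\<lambda>t. Phi_inv (h t)) C1_differentiable_on UNIV"
  using C1_differentiable_on_mult_inverse_sqrt[of h 1] assms
  by (simp add: Phi_inv_def add_pos_nonneg)

section \<open>C1 functions on the circle\<close>

definition circle_C1 :: "(complex \<Rightarrow> complex) \<Rightarrow> bool" where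
  "circle_C1 g \<longleftrightarrow> (\<lambda>t. g (cis t)) C1_differentiable_on UNIV"

lemma circle_C1_const: "circle_C1 (\<lambda>w. c)"
  by (simp add: circle_C1_def)

lemma circle_C1_add: "circle_C1 f \<Longrightarrow> circle_C1 g \<Longrightarrow> circle_C1 (\<lambda>w. f w + g w)"
  unfolding circle_C1_def by (rule C1_differentiable_on_add)

lemma circle_C1_cmult: "circle_C1 f \<Longrightarrow> circle_C1 (\<lambda>w. a * f w)"
  unfolding circle_C1_def by (rule C1_differentiable_on_mult) simp_all

lemma circle_C1_imp_continuous_cis:
  assumes "circle_C1 g"
  shows "continuous_on UNIV (\<lambda>t. g (cis t))"
  using assms C1_differentiable_imp_continuous_on unfolding circle_C1_def by blast

text \<open>Since \<open>cis\<close> has no continuous inverse on the whole circle, the angle is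
  chosen separately near each point \<open>w\<close>, as \<open>Arg (z / w) + Arg w\<close>: at
  \<open>z = w\<close> the quotient is 1, away from the branch cut of \<open>Arg\<close>.\<close>

lemma circle_C1_imp_continuous_on:
  assumes "circle_C1 g"
  shows "continuous_on (sphere 0 1) g"
proof (unfold continuous_on_eq_continuous_within, rule)
  fix w :: complex assume w: "w \<in> sphere 0 1"
  then have w': "cmod w = 1" "w \<noteq> 0" by auto
  have eq: "g (cis (Arg (z / w) + Arg w)) = g z" if "z \<in> sphere 0 1" for z
  proof -
    have "z / w \<noteq> 0" "cmod (z / w) = 1" using that w' by (auto simp: norm_divide)
    then have "cis (Arg (z / w)) = z / w" "cis (Arg w) = w"
      using w' by (simp_all add: cis_Arg sgn_div_norm)
    then show ?thesis using w' by (simp flip: cis_mult)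
  qed
  have "continuous (at w) (\<lambda>z. Arg (z / w))"
  proof -
    have "isCont Arg (w / w)" using w' by (intro continuous_at_Arg) auto
    moreover have "isCont (\<lambda>z. z / w) w" using w' by (intro continuous_intros)
    ultimately show ?thesis using isCont_o2 by blast
  qed
  then have "continuous (at w) (\<lambda>z. Arg (z / w) + Arg w)"
    by (intro continuous_intros)
  moreover have "isCont (\<lambda>t. g (cis t)) (Arg (w / w) + Arg w)"
    using circle_C1_imp_continuous_cis[OF assms] by (simp add: continuous_on_eq_continuous_at)
  ultimately have "isCont (\<lambda>z. g (cis (Arg (z / w) + Arg w))) w"
    by (rule isCont_o2[where g = "\<lambda>t. g (cis t)"])
  then have "continuous (at w within sphere 0 1) (\<lambda>z. g (cis (Arg (z / w) + Arg w)))"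
    by (rule continuous_at_imp_continuous_within)
  then show "continuous (at w within sphere 0 1) g"
    \<comment> \<open>The identity \<open>eq\<close> holds on the entire circle, so any positive
      radius would serve.\<close>
    by (rule continuous_transform_within[where \<delta> = 1]) (use w eq in auto)
qed

section \<open>Borel sets and the measure on the circle\<close>

lemma sets_borel_of: "sets (borel_of Y) = sigma_sets (topspace Y) {U. openin Y U}"
  unfolding borel_of_def by (intro sets_measure_of) (auto dest: openin_subset)

lemma space_borel_of: "space (borel_of Y) = topspace Y"
  unfolding borel_of_def by (intro space_measure_of) (auto dest: openin_subset)

lemma openin_in_borel_of: "openin Y U \<Longrightarrow> U \<in> sets (borel_of Y)"
  unfolding sets_borel_of by auto

lemma closedin_in_borel_of: "closedin Y U \<Longrightarrow> U \<in> sets (borel_of Y)"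
  using sets.compl_sets[OF openin_in_borel_of[of Y "topspace Y - U"]]
  by (simp add: closedin_def space_borel_of double_diff)

text \<open>The sigma-algebra of \<open>P\<close> is only required to contain the Borel sets of the
  circle; it may be larger, for instance a completion.\<close>

locale circle_base =
  fixes P :: "complex measure"
  assumes space_P: "space P = sphere 0 1"
    and sets_P: "sets (restrict_space borel (sphere 0 1)) \<subseteq> sets P"
    and full_support_P: "full_support P"
begin

lemma borel_measurable_continuous_on_circle:
  fixes f :: "complex \<Rightarrow> 'b::topological_space"
  assumes "continuous_on (sphere 0 1) f"
  shows "f \<in> borel_measurable P"
proof (rule measurableI)
  fix A :: "'b set" assume "A \<in> sets borel"
  moreover have "f \<in> borel_measurable (restrict_space borel (sphere 0 1))"
    by (rule borel_measurable_continuous_on_restrict[OF assms])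
  ultimately have "f -` A \<inter> space (restrict_space borel (sphere 0 1))
      \<in> sets (restrict_space borel (sphere 0 1))"
    by (rule measurable_sets[rotated])
  then show "f -` A \<inter> space P \<in> sets P"
    using sets_P by (auto simp: space_restrict_space space_P)
qed simp

text \<open>The set where \<open>f\<close> exceeds \<open>c\<close> is relatively open and contained
  in a null set, so full support forces it to be empty.\<close>

lemma AE_imp_everywhere:
  fixes f :: "complex \<Rightarrow> real"
  assumes f: "continuous_on (sphere 0 1) f" and ae: "AE w in P. f w \<le> c" and w: "w \<in> sphere 0 1"
  shows "f w \<le> c"
proof (rule ccontr)
  assume nle: "\<not> f w \<le> c"
  let ?U = "sphere 0 1 \<inter> f -` {c<..}"
  have "openin (top_of_set (space P)) ?U"
    unfolding space_P using f by (rule continuous_openin_preimage_gen) simp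
  moreover have "?U \<noteq> {}" using w nle by auto
  ultimately have "emeasure P ?U > 0"
    using full_support_P unfolding full_support_def by blast
  moreover obtain N where "{x \<in> space P. \<not> f x \<le> c} \<subseteq> N" "emeasure P N = 0" "N \<in> sets P"
    using ae by (rule AE_E)
  moreover from this have "?U \<subseteq> N"
    by (auto simp: space_P)
  then have "emeasure P ?U \<le> emeasure P N"
    using \<open>N \<in> sets P\<close> by (rule emeasure_mono)
  ultimately show False by simp
qed

section \<open>Coordinates of cocycles\<close>

definition coord :: "(complex \<Rightarrow> complex \<Rightarrow> complex) \<Rightarrow> complex \<Rightarrow> complex" where
  "coord T w = Phi (zeta P T w)"

definition of_coord :: "(complex \<Rightarrow> complex) \<Rightarrow> complex \<Rightarrow> complex \<Rightarrow> complex" where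
  "of_coord g = cocycle P (\<lambda>w. Phi_inv (g w))"

abbreviation E :: "(complex \<Rightarrow> complex \<Rightarrow> complex) set" where
  "E \<equiv> C1_cocycles P"

lemma of_coord_cong: "(\<And>w. w \<in> sphere 0 1 \<Longrightarrow> f w = g w) \<Longrightarrow> of_coord f = of_coord g"
  by (auto simp: of_coord_def cocycle_def space_P)

text \<open>Members of \<open>params P\<close> are extensional, so the parameter has to be
  restricted to the circle before \<open>zeta_cocycle\<close> can recover it.\<close>

lemma of_coord_eq: "of_coord g = cocycle P (\<lambda>w\<in>sphere 0 1. Phi_inv (g w))"
  by (auto simp: of_coord_def cocycle_def space_P)

lemma Phi_inv_in_params:
  assumes "circle_C1 g"
  shows "(\<lambda>w\<in>sphere 0 1. Phi_inv (g w)) \<in> params P"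
proof -
  have "(\<lambda>w. Phi_inv (g w)) \<in> borel_measurable P"
    by (intro borel_measurable_continuous_on_circle continuous_intros
        circle_C1_imp_continuous_on assms)
  then have "(\<lambda>w\<in>sphere 0 1. Phi_inv (g w)) \<in> borel_measurable P"
    by (rule measurable_cong[THEN iffD1, rotated]) (simp add: space_P)
  then show ?thesis
    by (auto simp: params_def space_P Phi_inv_in_ball)
qed

lemma of_coord_in_E:
  assumes "circle_C1 g"
  shows "of_coord g \<in> E"
  unfolding C1_cocycles_def of_coord_eq
proof (intro imageI CollectI conjI)
  show "(\<lambda>w\<in>sphere 0 1. Phi_inv (g w)) \<in> params P"
    by (rule Phi_inv_in_params[OF assms])
  show "(\<lambda>t. (\<lambda>w\<in>sphere 0 1. Phi_inv (g w)) (cis t)) C1_differentiable_on UNIV"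
    using C1_differentiable_on_Phi_inv[OF assms[unfolded circle_C1_def]] by simp
qed

text \<open>Together with \<open>of_coord_coord\<close> this identifies \<open>E\<close> with the C1
  functions on the circle. The cocycle operations become pointwise addition and scaling, and
  identities in \<open>E\<close> can be checked pointwise through \<open>E_eqI\<close>.\<close>

lemma coord_of_coord:
  assumes "circle_C1 g" "w \<in> sphere 0 1"
  shows "coord (of_coord g) w = g w"
  using assms by (simp add: coord_def of_coord_eq zeta_cocycle[OF Phi_inv_in_params] Phi_Phi_inv)

lemma E_cases:
  assumes "T \<in> E"
  obtains \<zeta> where "\<zeta> \<in> params P" "circle_C1 \<zeta>" "T = cocycle P \<zeta>" "zeta P T = \<zeta>"
  using assms by (auto simp: C1_cocycles_def circle_C1_def zeta_cocycle)

lemma circle_C1_coord: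
  assumes "T \<in> E"
  shows "circle_C1 (coord T)"
  using assms
proof (cases rule: E_cases)
  case (1 \<zeta>)
  then have "cmod (\<zeta> (cis t)) < 1" for t
    by (auto simp: params_def space_P PiE_iff)
  then show ?thesis
    using 1 C1_differentiable_on_Phi[of "\<lambda>t. \<zeta> (cis t)"] by (simp add: circle_C1_def coord_def)
qed

lemma of_coord_coord:
  assumes "T \<in> E"
  shows "of_coord (coord T) = T"
  using assms
proof (cases rule: E_cases)
  case (1 \<zeta>)
  then have "Phi_inv (coord T w) = \<zeta> w" if "w \<in> sphere 0 1" for w
    using that by (auto simp: coord_def params_def space_P PiE_iff intro!: Phi_inv_Phi)
  then show ?thesis
    using 1 by (auto simp: of_coord_def cocycle_def space_P)
qed

lemma E_eqI:
  assumes "S \<in> E" "T \<in> E" "\<And>w. w \<in> sphere 0 1 \<Longrightarrow> coord S w = coord T w"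
  shows "S = T"
  using of_coord_cong[of "coord S" "coord T"] assms of_coord_coord by metis

lemma E_subset_cocycles: "E \<subseteq> cocycles P"
  by (auto simp: C1_cocycles_def cocycles_def)

lemma cocycle_add_eq: "cocycle_add P S T = of_coord (\<lambda>w. coord S w + coord T w)"
  by (simp add: cocycle_add_def of_coord_def coord_def)

lemma cocycle_scale_eq: "cocycle_scale P a T = of_coord (\<lambda>w. a * coord T w)"
  by (simp add: cocycle_scale_def of_coord_def coord_def)

lemma add_in_E: "S \<in> E \<Longrightarrow> T \<in> E \<Longrightarrow> cocycle_add P S T \<in> E"
  by (simp add: cocycle_add_eq of_coord_in_E circle_C1_add circle_C1_coord)

lemma scale_in_E: "T \<in> E \<Longrightarrow> cocycle_scale P a T \<in> E"
  by (simp add: cocycle_scale_eq of_coord_in_E circle_C1_cmult circle_C1_coord)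

lemma coord_add:
  "S \<in> E \<Longrightarrow> T \<in> E \<Longrightarrow> w \<in> sphere 0 1 \<Longrightarrow> coord (cocycle_add P S T) w = coord S w + coord T w"
  by (subst cocycle_add_eq, subst coord_of_coord) (auto intro: circle_C1_add circle_C1_coord)

lemma coord_scale:
  "T \<in> E \<Longrightarrow> w \<in> sphere 0 1 \<Longrightarrow> coord (cocycle_scale P a T) w = a * coord T w"
  by (subst cocycle_scale_eq, subst coord_of_coord) (auto intro: circle_C1_cmult circle_C1_coord)

section \<open>Stability of cocycles without zeros\<close>

text \<open>The derivative at the origin has modulus \<open>cmod (\<zeta> w)\<close>. By compactness
  this attains its minimum over the circle, which is positive and bounds the essential infimum from
  below.\<close>

lemma stable_if_nonzero:
  assumes T: "T \<in> E" and nz: "\<And>w. w \<in> sphere 0 1 \<Longrightarrow> coord T w \<noteq> 0"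
  shows "stable_cocycle P T"
  using T
proof (cases rule: E_cases)
  case (1 \<zeta>)
  have cont: "continuous_on (sphere 0 1) (\<lambda>w. cmod (\<zeta> w))"
    using 1 by (intro continuous_intros circle_C1_imp_continuous_on)
  obtain w0 where w0: "w0 \<in> sphere 0 1" "\<And>w. w \<in> sphere 0 1 \<Longrightarrow> cmod (\<zeta> w0) \<le> cmod (\<zeta> w)"
    using continuous_attains_inf[OF _ _ cont] by auto
  \<comment> \<open>\<open>Phi\<close> sends 0 to 0, so a zero of the parameter would be a zero of
    the coordinate.\<close>
  have "\<zeta> w0 \<noteq> 0" using nz[OF w0(1)] 1 by (auto simp: coord_def Phi_def)
  have deriv: "cmod (deriv (T w) 0) = cmod (\<zeta> w)" if "w \<in> sphere 0 1" for w
    using that 1 by (simp add: cocycle_def space_P deriv_blaschke_0)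
  have "esssup P (\<lambda>w. - ereal (cmod (deriv (T w) 0))) \<le> - ereal (cmod (\<zeta> w0))"
  proof (rule esssup_I)
    have "(\<lambda>w. - ereal (cmod (\<zeta> w))) \<in> borel_measurable P"
      using borel_measurable_continuous_on_circle[OF cont] by measurable
    then show "(\<lambda>w. - ereal (cmod (deriv (T w) 0))) \<in> borel_measurable P"
      by (rule measurable_cong[THEN iffD1, rotated]) (simp add: space_P deriv)
    show "AE w in P. - ereal (cmod (deriv (T w) 0)) \<le> - ereal (cmod (\<zeta> w0))"
      by (rule AE_I2) (use w0(2) deriv in \<open>simp add: space_P\<close>)
  qed
  then have "ereal (cmod (\<zeta> w0)) \<le> essinf P (\<lambda>w. ereal (cmod (deriv (T w) 0)))"
    unfolding essinf_def by (metis ereal_minus_le_minus ereal_uminus_uminus)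
  moreover have "0 < ereal (cmod (\<zeta> w0))" using \<open>\<zeta> w0 \<noteq> 0\<close> by simp
  ultimately show ?thesis
    unfolding stable_cocycle_def by (rule less_le_trans[rotated])
qed

section \<open>The isometric embedding into bounded continuous functions\<close>

text \<open>Passing to the angle replaces functions on the circle by periodic functions on all of
  the reals, which form the normed space \<open>real \<Rightarrow>\<^sub>C complex\<close> with its
  sup metric.\<close>

definition emb :: "(complex \<Rightarrow> complex \<Rightarrow> complex) \<Rightarrow> real \<Rightarrow>\<^sub>C complex" where
  "emb T = Bcontfun (\<lambda>t. coord T (cis t))"

lemma emb_apply:
  assumes "T \<in> E"
  shows "apply_bcontfun (emb T) t = coord T (cis t)"
proof -
  have "compact (coord T ` sphere 0 1)"
    by (intro compact_continuous_image circle_C1_imp_continuous_on circle_C1_coord assms) simp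
  then have "bounded (range (\<lambda>t. coord T (cis t)))"
    by (rule bounded_subset[OF compact_imp_bounded]) auto
  then have "(\<lambda>t. coord T (cis t)) \<in> bcontfun"
    using circle_C1_imp_continuous_cis[OF circle_C1_coord[OF assms]] by (simp add: bcontfun_def)
  then show ?thesis
    by (simp add: emb_def Bcontfun_inverse)
qed

lemma sphere_eq_cis: "w \<in> sphere 0 1 \<Longrightarrow> w = cis (Arg w)"
  by (subst cis_Arg) (auto simp: sgn_eq)

lemma dist_emb_le_iff:
  assumes "S \<in> E" "T \<in> E"
  shows "dist (emb S) (emb T) \<le> e \<longleftrightarrow> (\<forall>w\<in>sphere 0 1. cmod (coord S w - coord T w) \<le> e)"
proof
  assume le: "dist (emb S) (emb T) \<le> e"
  have "cmod (coord S (cis t) - coord T (cis t)) \<le> e" for t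
    using order_trans[OF dist_bounded[of "emb S" t "emb T"] le] assms
    by (simp add: emb_apply dist_norm)
  then show "\<forall>w\<in>sphere 0 1. cmod (coord S w - coord T w) \<le> e"
    by (metis sphere_eq_cis)
next
  assume "\<forall>w\<in>sphere 0 1. cmod (coord S w - coord T w) \<le> e"
  then show "dist (emb S) (emb T) \<le> e"
    using assms by (intro dist_bound) (simp add: emb_apply dist_norm)
qed

lemma emb_inj: "S \<in> E \<Longrightarrow> T \<in> E \<Longrightarrow> emb S = emb T \<Longrightarrow> S = T"
  using dist_emb_le_iff[of S T 0] by (intro E_eqI) auto

text \<open>The sup metric dominates the essential supremum at once. Conversely, the essential
  supremum bounds the continuous difference of coordinates almost everywhere, hence everywhere by
  full support.\<close>

lemma cocycle_dist_eq:
  assumes "S \<in> E" "T \<in> E"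
  shows "cocycle_dist P S T = ereal (dist (emb S) (emb T))"
proof (rule antisym)
  let ?f = "\<lambda>w. cmod (coord S w - coord T w)"
  have cont: "continuous_on (sphere 0 1) ?f"
    by (intro continuous_intros circle_C1_imp_continuous_on circle_C1_coord assms)
  have D: "cocycle_dist P S T = esssup P (\<lambda>w. ereal (?f w))"
    by (simp add: cocycle_dist_def coord_def)
  have ae: "AE w in P. ereal (?f w) \<le> cocycle_dist P S T"
    unfolding D by (rule esssup_AE)
  show "cocycle_dist P S T \<le> ereal (dist (emb S) (emb T))"
    unfolding D
  proof (rule esssup_I)
    show "(\<lambda>w. ereal (?f w)) \<in> borel_measurable P"
      using borel_measurable_continuous_on_circle[OF cont] by measurable
    show "AE w in P. ereal (?f w) \<le> ereal (dist (emb S) (emb T))"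
      by (rule AE_I2) (use dist_emb_le_iff[OF assms, of "dist (emb S) (emb T)"] in \<open>simp add: space_P\<close>)
  qed
  show "ereal (dist (emb S) (emb T)) \<le> cocycle_dist P S T"
  proof (cases "cocycle_dist P S T")
    case (real r)
    then have "AE w in P. ?f w \<le> r" using ae by simp
    then have "\<forall>w\<in>sphere 0 1. ?f w \<le> r"
      using AE_imp_everywhere[OF cont] by blast
    then show ?thesis
      using real dist_emb_le_iff[OF assms] by simp
  next
    \<comment> \<open>The value minus infinity would make every statement true almost everywhere.
      The bound -1 is any negative number, contradicted by the nonnegative norm at the point
      1.\<close>
    case MInf
    then have "AE w in P. False" using ae by simp
    then have "AE w in P. ?f w \<le> - 1" by (rule eventually_mono) simp
    then have "?f 1 \<le> - 1"
      by (rule AE_imp_everywhere[OF cont]) simp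
    moreover have "0 \<le> ?f 1" by simp
    ultimately show ?thesis by linarith
  qed simp
qed

section \<open>The topology of the space of C1 cocycles\<close>

text \<open>Stated for all cocycles, where distances may be infinite, because open subsets of
  \<open>E\<close> must be extended to open subsets of the whole space
  \<open>cocycles P\<close>.\<close>

lemma cocycle_dist_triangle:
  assumes "R \<in> cocycles P" "S \<in> cocycles P" "T \<in> cocycles P"
  shows "cocycle_dist P R T \<le> cocycle_dist P R S + cocycle_dist P S T"
proof -
  have meas: "(\<lambda>w. Phi (zeta P T w)) \<in> borel_measurable P" if "T \<in> cocycles P" for T
  proof -
    have "zeta P T \<in> borel_measurable P"
      using that by (auto simp: cocycles_def zeta_cocycle params_def)
    then show ?thesis by measurable
  qed
  note [measurable] = meas[OF assms(1)] meas[OF assms(2)] meas[OF assms(3)]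
  let ?d = "\<lambda>S T w. ereal (cmod (Phi (zeta P S w) - Phi (zeta P T w)))"
  have "esssup P (?d R T) \<le> esssup P (\<lambda>w. ?d R S w + ?d S T w)"
    by (rule esssup_mono) (measurable, simp add: dist_triangle flip: dist_norm)
  also have "\<dots> \<le> esssup P (?d R S) + esssup P (?d S T)"
    by (rule esssup_add)
  finally show ?thesis
    by (simp add: cocycle_dist_def)
qed

text \<open>On \<open>E\<close> the distance is the one pulled back along \<open>emb\<close>. In one
  direction an open set is rewritten as the preimage of a union of balls; in the other it is
  enlarged to an open set of all cocycles.\<close>

lemma C1_topology_eq: "subtopology (cocycle_topology P) E = pullback_topology E emb euclidean"
proof (rule topology_eq[THEN iffD2], intro allI iffI)
  fix U assume "openin (subtopology (cocycle_topology P) E) U"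
  then obtain V where V: "openin (cocycle_topology P) V" "U = V \<inter> E"
    by (auto simp: openin_subtopology)
  have "\<exists>e>0. \<forall>T\<in>E. dist (emb T) (emb S) < e \<longrightarrow> T \<in> V" if S: "S \<in> U" for S
  proof -
    obtain e where e: "e > 0" "\<forall>T\<in>cocycles P. cocycle_dist P S T < ereal e \<longrightarrow> T \<in> V"
      using V S by (auto simp: openin_cocycle_topology)
    then show ?thesis
      using V S E_subset_cocycles
      by (intro exI[of _ e]) (auto simp: cocycle_dist_eq dist_commute)
  qed
  then obtain e where e: "\<And>S. S \<in> U \<Longrightarrow> e S > 0"
      "\<And>S T. S \<in> U \<Longrightarrow> T \<in> E \<Longrightarrow> dist (emb T) (emb S) < e S \<Longrightarrow> T \<in> V"
    by metis
  have "U = emb -` (\<Union>S\<in>U. ball (emb S) (e S)) \<inter> E"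
  proof (intro equalityI subsetI IntI vimageI2)
    fix T assume T: "T \<in> U"
    then show "emb T \<in> (\<Union>S\<in>U. ball (emb S) (e S))" "T \<in> E"
      using V(2) e(1)[OF T] by (auto intro: bexI[of _ T])
  next
    fix T assume "T \<in> emb -` (\<Union>S\<in>U. ball (emb S) (e S)) \<inter> E"
    then obtain S where "S \<in> U" "dist (emb T) (emb S) < e S" "T \<in> E"
      by (auto simp: dist_commute)
    then show "T \<in> U"
      using e(2) V(2) by blast
  qed
  then show "openin (pullback_topology E emb euclidean) U"
    unfolding openin_pullback_topology by (intro exI conjI) auto
next
  fix U assume "openin (pullback_topology E emb euclidean) U"
  then obtain W where W: "open W" "U = emb -` W \<inter> E"
    by (auto simp: openin_pullback_topology)
  \<comment> \<open>The union of those balls in the whole space, centred in \<open>U\<close>, whose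
    trace on \<open>E\<close> stays inside \<open>U\<close>; consequently \<open>V\<close> meets
    \<open>E\<close> exactly in \<open>U\<close>.\<close>
  define V where "V = {T \<in> cocycles P. \<exists>S\<in>U. \<exists>e. cocycle_dist P S T < ereal e \<and>
      (\<forall>T'\<in>E. cocycle_dist P S T' < ereal e \<longrightarrow> T' \<in> U)}"
  have "openin (cocycle_topology P) V"
    unfolding openin_cocycle_topology
  proof (intro conjI ballI)
    show "V \<subseteq> cocycles P" by (auto simp: V_def)
    fix T assume "T \<in> V"
    then obtain S e where *: "T \<in> cocycles P" "S \<in> U" "cocycle_dist P S T < ereal e"
        "\<forall>T'\<in>E. cocycle_dist P S T' < ereal e \<longrightarrow> T' \<in> U"
      by (auto simp: V_def)
    \<comment> \<open>A real number \<open>r\<close> strictly between the distance and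
      \<open>e\<close> yields the real radius \<open>e - r\<close> and avoids subtracting extended
      reals.\<close>
    obtain r where r: "cocycle_dist P S T < ereal r" "r < e"
      using ereal_dense2[OF *(3)] by auto
    have "T' \<in> V" if T': "T' \<in> cocycles P" "cocycle_dist P T T' < ereal (e - r)" for T'
    proof -
      have "cocycle_dist P S T' \<le> cocycle_dist P S T + cocycle_dist P T T'"
        using * T' W E_subset_cocycles by (intro cocycle_dist_triangle) auto
      also have "\<dots> < ereal r + ereal (e - r)"
        by (rule ereal_add_strict_mono2) (use r T' in auto)
      finally show ?thesis
        using * T' by (auto simp: V_def)
    qed
    then show "\<exists>e>0. \<forall>T'\<in>cocycles P. cocycle_dist P T T' < ereal e \<longrightarrow> T' \<in> V"
      using r(2) by (intro exI[of _ "e - r"]) auto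
  qed
  moreover have "U = V \<inter> E"
  proof (intro equalityI subsetI)
    fix T assume T: "T \<in> U"
    then obtain e where e: "e > 0" "ball (emb T) e \<subseteq> W"
      using W by (auto simp: open_contains_ball)
    have "T' \<in> U" if "T' \<in> E" "cocycle_dist P T T' < ereal e" for T'
      using that T W e by (auto simp: cocycle_dist_eq)
    moreover have "cocycle_dist P T T < ereal e"
      using T W e by (simp add: cocycle_dist_eq)
    ultimately show "T \<in> V \<inter> E"
      using T W E_subset_cocycles unfolding V_def by blast
  next
    fix T assume "T \<in> V \<inter> E"
    then show "T \<in> U" by (auto simp: V_def)
  qed
  ultimately show "openin (subtopology (cocycle_topology P) E) U"
    by (auto simp: openin_subtopology)
qed

abbreviation X :: "(complex \<Rightarrow> complex \<Rightarrow> complex) topology" where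
  "X \<equiv> subtopology (cocycle_topology P) E"

lemma topspace_X: "topspace X = E"
  by (simp add: C1_topology_eq topspace_pullback_topology)

lemma openin_X_iff:
  "openin X U \<longleftrightarrow>
    U \<subseteq> E \<and> (\<forall>S\<in>U. \<exists>e>0. \<forall>T\<in>E. dist (emb S) (emb T) < e \<longrightarrow> T \<in> U)"
proof (intro iffI conjI)
  assume "openin X U"
  then obtain W where W: "open W" "U = emb -` W \<inter> E"
    by (auto simp: C1_topology_eq openin_pullback_topology)
  then show "U \<subseteq> E" by auto
  show "\<forall>S\<in>U. \<exists>e>0. \<forall>T\<in>E. dist (emb S) (emb T) < e \<longrightarrow> T \<in> U"
  proof
    fix S assume "S \<in> U"
    then obtain e where "e > 0" "ball (emb S) e \<subseteq> W"
      using W by (auto simp: open_contains_ball)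
    then show "\<exists>e>0. \<forall>T\<in>E. dist (emb S) (emb T) < e \<longrightarrow> T \<in> U"
      using W by (intro exI[of _ e]) auto
  qed
next
  assume U: "U \<subseteq> E \<and> (\<forall>S\<in>U. \<exists>e>0. \<forall>T\<in>E. dist (emb S) (emb T) < e \<longrightarrow> T \<in> U)"
  then obtain e where e: "\<And>S. S \<in> U \<Longrightarrow> e S > 0"
      "\<And>S T. S \<in> U \<Longrightarrow> T \<in> E \<Longrightarrow> dist (emb S) (emb T) < e S \<Longrightarrow> T \<in> U"
    by metis
  have "U = emb -` (\<Union>S\<in>U. ball (emb S) (e S)) \<inter> E"
  proof (intro equalityI subsetI IntI vimageI2)
    fix T assume "T \<in> U"
    then show "emb T \<in> (\<Union>S\<in>U. ball (emb S) (e S))" "T \<in> E"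
      using U e(1) by (auto intro: bexI[of _ T])
  qed (use e(2) in auto)
  then show "openin X U"
    unfolding C1_topology_eq openin_pullback_topology by (intro exI conjI) auto
qed

lemma continuous_map_emb: "continuous_map X euclidean emb"
  using continuous_map_pullback[of euclidean euclidean id E emb]
  by (simp add: C1_topology_eq)

text \<open>The universal property of the pullback topology: continuity into \<open>X\<close> can be
  tested after composing with \<open>emb\<close>.\<close>

lemma continuous_map_into_X:
  assumes "continuous_map Y euclidean (\<lambda>y. emb (f y))" "\<And>y. y \<in> topspace Y \<Longrightarrow> f y \<in> E"
  shows "continuous_map Y X f"
  unfolding C1_topology_eq
  using assms by (intro continuous_map_pullback') (auto simp: o_def)

text \<open>Injectivity of \<open>emb\<close> on \<open>E\<close> makes the pulled back distance a
  metric, and \<open>openin_X_iff\<close> is its ball criterion.\<close>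

lemma metrizable_X: "metrizable_space X"
proof -
  interpret Metric_space E "\<lambda>S T. dist (emb S) (emb T)"
    by unfold_locales (auto simp: dist_commute intro: dist_triangle dest: emb_inj)
  have "X = mtopology"
  proof (rule topology_eq[THEN iffD2], rule allI)
    fix U
    have "(\<forall>T\<in>E. dist (emb S) (emb T) < e \<longrightarrow> T \<in> U) \<longleftrightarrow> mball S e \<subseteq> U" if "U \<subseteq> E" "S \<in> U" for S e
      using that by (auto simp only: mball_def)
    then show "openin X U \<longleftrightarrow> openin mtopology U"
      unfolding openin_X_iff openin_mtopology by blast
  qed
  then show ?thesis
    using metrizable_space_mtopology by simp
qed

section \<open>The topological vector space structure\<close>

lemma emb_add: "S \<in> E \<Longrightarrow> T \<in> E \<Longrightarrow> emb (cocycle_add P S T) = emb S + emb T"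
  by (rule bcontfun_eqI) (simp add: emb_apply add_in_E coord_add)

text \<open>Expresses complex scaling through the real scalar multiplication of bounded continuous
  functions and the single map of multiplication by \<open>\<i>\<close>. Joint continuity of scaling
  then reduces to continuity of that map.\<close>

lemma emb_scale:
  "T \<in> E \<Longrightarrow> emb (cocycle_scale P a T) = Re a *\<^sub>R emb T + Im a *\<^sub>R emb (cocycle_scale P \<i> T)"
proof (rule bcontfun_eqI)
  fix t assume T: "T \<in> E"
  have "a * coord T (cis t) = Re a *\<^sub>R coord T (cis t) + Im a *\<^sub>R (\<i> * coord T (cis t))"
    by (subst complex_eq[of a]) (simp add: scaleR_conv_of_real algebra_simps)
  then show "apply_bcontfun (emb (cocycle_scale P a T)) t =
      apply_bcontfun (Re a *\<^sub>R emb T + Im a *\<^sub>R emb (cocycle_scale P \<i> T)) t"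
    using T by (simp add: emb_apply scale_in_E coord_scale)
qed

text \<open>Since \<open>\<i>\<close> has modulus 1, both distances have the same upper bounds,
  hence are equal.\<close>

lemma dist_emb_scale_i:
  "S \<in> E \<Longrightarrow> T \<in> E \<Longrightarrow>
    dist (emb (cocycle_scale P \<i> S)) (emb (cocycle_scale P \<i> T)) = dist (emb S) (emb T)"
proof -
  assume ST: "S \<in> E" "T \<in> E"
  have "dist (emb (cocycle_scale P \<i> S)) (emb (cocycle_scale P \<i> T)) \<le> e \<longleftrightarrow>
      dist (emb S) (emb T) \<le> e" for e
    using ST
    by (simp add: dist_emb_le_iff scale_in_E coord_scale norm_mult flip: right_diff_distrib)
  then show ?thesis
    by (meson order_antisym order_refl)
qed

lemma continuous_map_emb_scale_i: "continuous_map X euclidean (\<lambda>T. emb (cocycle_scale P \<i> T))"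
proof -
  have "openin X {T \<in> E. emb (cocycle_scale P \<i> T) \<in> W}" if "open W" for W
  proof -
    have "\<exists>e>0. \<forall>T\<in>E. dist (emb S) (emb T) < e \<longrightarrow> emb (cocycle_scale P \<i> T) \<in> W"
      if S: "S \<in> E" "emb (cocycle_scale P \<i> S) \<in> W" for S
    proof -
      obtain e where e: "e > 0" "ball (emb (cocycle_scale P \<i> S)) e \<subseteq> W"
        using openE[OF \<open>open W\<close> S(2)] by blast
      then have "emb (cocycle_scale P \<i> T) \<in> W" if "T \<in> E" "dist (emb S) (emb T) < e" for T
        using that S(1) by (intro subsetD[OF e(2)]) (simp add: dist_emb_scale_i)
      with e(1) show ?thesis by blast
    qed
    then show ?thesis
      unfolding openin_X_iff by simp
  qed
  then show ?thesis
    by (simp only: continuous_map topspace_X) simp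
qed

lemma metrizable_tvs_X: "metrizable_tvs X (cocycle_add P) (cocycle_scale P)"
proof
  show "metrizable_space X" by (rule metrizable_X)
  have fst: "continuous_map (prod_topology X X) euclidean (\<lambda>p. emb (fst p))"
    and snd: "continuous_map (prod_topology Y X) euclidean (\<lambda>p. emb (snd p))"
    and sndi: "continuous_map (prod_topology Y X) euclidean (\<lambda>p. emb (cocycle_scale P \<i> (snd p)))"
    for Y :: "complex topology"
    using continuous_map_compose[OF continuous_map_fst continuous_map_emb]
      continuous_map_compose[OF continuous_map_snd continuous_map_emb]
      continuous_map_compose[OF continuous_map_snd continuous_map_emb_scale_i]
    by (simp_all add: o_def)
  have snd': "continuous_map (prod_topology X X) euclidean (\<lambda>p. emb (snd p))"
    using continuous_map_compose[OF continuous_map_snd continuous_map_emb] by (simp add: o_def)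
  show "continuous_map (prod_topology X X) X (\<lambda>(x, y). cocycle_add P x y)"
  proof (rule continuous_map_into_X)
    have "continuous_map (prod_topology X X) euclidean (\<lambda>p. emb (fst p) + emb (snd p))"
      by (intro continuous_map_add fst snd')
    then show "continuous_map (prod_topology X X) euclidean (\<lambda>p. emb (case p of (x, y) \<Rightarrow> cocycle_add P x y))"
      by (rule continuous_map_eq) (auto simp: topspace_X emb_add)
  qed (auto simp: topspace_X add_in_E)
  show "continuous_map (prod_topology euclidean X) X (\<lambda>(a, x). cocycle_scale P a x)"
  proof (rule continuous_map_into_X)
    have coef: "continuous_map (prod_topology euclidean X) euclidean (\<lambda>p. Re (fst p))"
      "continuous_map (prod_topology euclidean X) euclidean (\<lambda>p. Im (fst p))"
      using continuous_map_compose[OF continuous_map_fst, of euclidean euclidean Re X]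
        continuous_map_compose[OF continuous_map_fst, of euclidean euclidean Im X]
      by (auto simp: o_def continuous_on_Re continuous_on_Im)
    have "continuous_map (prod_topology euclidean X) euclidean
        (\<lambda>p. Re (fst p) *\<^sub>R emb (snd p) + Im (fst p) *\<^sub>R emb (cocycle_scale P \<i> (snd p)))"
      \<comment> \<open>Real scaling and addition are jointly continuous in the normed target space,
        so limits may be taken term by term.\<close>
      using coef snd sndi unfolding continuous_map_atin
      by (auto intro!: tendsto_add tendsto_scaleR)
    then show "continuous_map (prod_topology euclidean X) euclidean
        (\<lambda>p. emb (case p of (a, x) \<Rightarrow> cocycle_scale P a x))"
      by (rule continuous_map_eq) (auto simp: topspace_X intro: emb_scale[symmetric])
  qed (auto simp: topspace_X scale_in_E)
  show "\<exists>z\<in>topspace X. \<forall>x\<in>topspace X. cocycle_add P x z = x \<and> (\<exists>y\<in>topspace X. cocycle_add P x y = z)"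
    unfolding topspace_X
  proof (rule bexI[of _ "of_coord (\<lambda>w. 0)"], rule ballI)
    let ?z = "of_coord (\<lambda>w. 0)"
    show z: "?z \<in> E" by (intro of_coord_in_E circle_C1_const)
    fix T assume T: "T \<in> E"
    then have "cocycle_add P T ?z = T"
      by (intro E_eqI) (simp_all add: z add_in_E coord_add coord_of_coord circle_C1_const)
    \<comment> \<open>The additive inverse of \<open>T\<close> is its multiple by -1.\<close>
    moreover have "cocycle_add P T (cocycle_scale P (-1) T) = ?z"
      using T by (intro E_eqI)
        (simp_all add: z add_in_E scale_in_E coord_add coord_scale coord_of_coord circle_C1_const)
    ultimately show "cocycle_add P T ?z = T \<and> (\<exists>y\<in>E. cocycle_add P T y = ?z)"
      using scale_in_E[OF T] by blast
  qed
  fix R S T and a b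
  show "cocycle_add P (cocycle_add P R S) T = cocycle_add P R (cocycle_add P S T)"
    if "R \<in> topspace X" "S \<in> topspace X" "T \<in> topspace X"
    using that unfolding topspace_X
    by (intro E_eqI) (simp_all add: add_in_E coord_add add.assoc)
  show "cocycle_add P R S = cocycle_add P S R" if "R \<in> topspace X" "S \<in> topspace X"
    using that unfolding topspace_X
    by (intro E_eqI) (simp_all add: add_in_E coord_add add.commute)
  show "cocycle_scale P a (cocycle_add P R S) = cocycle_add P (cocycle_scale P a R) (cocycle_scale P a S)"
    if "R \<in> topspace X" "S \<in> topspace X"
    using that unfolding topspace_X
    by (intro E_eqI) (simp_all add: add_in_E scale_in_E coord_add coord_scale distrib_left)
  show "cocycle_scale P (a + b) R = cocycle_add P (cocycle_scale P a R) (cocycle_scale P b R)"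
    if "R \<in> topspace X"
    using that unfolding topspace_X
    by (intro E_eqI) (simp_all add: add_in_E scale_in_E coord_add coord_scale distrib_right)
  show "cocycle_scale P a (cocycle_scale P b R) = cocycle_scale P (a * b) R" if "R \<in> topspace X"
    using that unfolding topspace_X
    by (intro E_eqI) (simp_all add: scale_in_E coord_scale mult.assoc)
  show "cocycle_scale P 1 R = R" if "R \<in> topspace X"
    using that unfolding topspace_X
    by (intro E_eqI) (simp_all add: scale_in_E coord_scale)
qed

section \<open>Cocycles without zeros and their translates\<close>

text \<open>Taking for \<open>S\<close> the zero vector gives the cocycles whose coordinate has no
  zero. A general \<open>S\<close> describes a translate of that set without mentioning images, as
  \<open>translate_nonzero_shift\<close> shows.\<close>

definition nonzero_shift :: "(complex \<Rightarrow> complex \<Rightarrow> complex) \<Rightarrow> (complex \<Rightarrow> complex \<Rightarrow> complex) set" where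
  "nonzero_shift S = {T \<in> E. \<forall>w\<in>sphere 0 1. coord T w \<noteq> coord S w}"

lemma openin_nonzero_shift:
  assumes "S \<in> E"
  shows "openin X (nonzero_shift S)"
proof -
  have "\<exists>e>0. \<forall>T'\<in>E. dist (emb T) (emb T') < e \<longrightarrow> T' \<in> nonzero_shift S"
    if T: "T \<in> nonzero_shift S" for T
  proof -
    have TE: "T \<in> E" using T by (simp add: nonzero_shift_def)
    have cont: "continuous_on (sphere 0 1) (\<lambda>w. cmod (coord T w - coord S w))"
      by (intro continuous_intros circle_C1_imp_continuous_on circle_C1_coord assms TE)
    obtain w0 where w0: "w0 \<in> sphere 0 1"
        "\<And>w. w \<in> sphere 0 1 \<Longrightarrow> cmod (coord T w0 - coord S w0) \<le> cmod (coord T w - coord S w)"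
      using continuous_attains_inf[OF _ _ cont] by auto
    show ?thesis
    \<comment> \<open>The radius is the minimum over the circle of the gap between the two
      coordinates, positive by compactness. A perturbation closer than this cannot create a
      coincidence with \<open>coord S\<close>.\<close>
    proof (intro exI[of _ "cmod (coord T w0 - coord S w0)"] conjI ballI impI)
      show "0 < cmod (coord T w0 - coord S w0)"
        using T w0(1) by (simp add: nonzero_shift_def)
      fix T' assume T': "T' \<in> E" "dist (emb T) (emb T') < cmod (coord T w0 - coord S w0)"
      have "coord T' w \<noteq> coord S w" if w: "w \<in> sphere 0 1" for w
      proof
        assume "coord T' w = coord S w"
        then have "cmod (coord T w - coord S w) \<le> dist (emb T) (emb T')"
          using dist_emb_le_iff[OF TE T'(1), THEN iffD1, OF order_refl, rule_format, OF w] by simp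
        then show False using w0(2)[OF w] T'(2) by linarith
      qed
      then show "T' \<in> nonzero_shift S" using T'(1) by (simp add: nonzero_shift_def)
    qed
  qed
  then show ?thesis
    unfolding openin_X_iff by (simp add: nonzero_shift_def)
qed

text \<open>Adding \<open>S\<close> shifts coordinates by \<open>coord S\<close>, so zeros turn into
  coincidences with \<open>coord S\<close>; the preimage of \<open>T\<close> is \<open>T\<close>
  minus \<open>S\<close>.\<close>

lemma translate_nonzero_shift:
  assumes S: "S \<in> E"
  shows "(\<lambda>T. cocycle_add P T S) ` nonzero_shift (of_coord (\<lambda>w. 0)) = nonzero_shift S"
proof (intro equalityI subsetI)
  fix T assume "T \<in> (\<lambda>T. cocycle_add P T S) ` nonzero_shift (of_coord (\<lambda>w. 0))"
  then show "T \<in> nonzero_shift S"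
    using S by (auto simp: nonzero_shift_def add_in_E coord_add coord_of_coord circle_C1_const)
next
  fix T assume T: "T \<in> nonzero_shift S"
  then have TE: "T \<in> E" by (simp add: nonzero_shift_def)
  let ?R = "cocycle_add P T (cocycle_scale P (-1) S)"
  have "cocycle_add P ?R S = T"
    using S TE by (intro E_eqI) (simp_all add: add_in_E scale_in_E coord_add coord_scale)
  moreover have "?R \<in> nonzero_shift (of_coord (\<lambda>w. 0))"
    using S T TE
    by (auto simp: nonzero_shift_def add_in_E scale_in_E coord_add coord_scale coord_of_coord
        circle_C1_const)
  ultimately show "T \<in> (\<lambda>T. cocycle_add P T S) ` nonzero_shift (of_coord (\<lambda>w. 0))"
    by (metis imageI)
qed

section \<open>Lebesgue measure on the line of constant coordinates\<close>

text \<open>It is the coordinate that equals \<open>c\<close>, while the parameter is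
  \<open>Phi_inv c\<close>; so \<open>c\<close> ranges over the whole plane and the image is a
  complex line in \<open>E\<close>.\<close>

definition const_cocycle :: "complex \<Rightarrow> complex \<Rightarrow> complex \<Rightarrow> complex" where
  "const_cocycle c = of_coord (\<lambda>w. c)"

lemma const_cocycle_in_E: "const_cocycle c \<in> E"
  unfolding const_cocycle_def by (intro of_coord_in_E circle_C1_const)

lemma coord_const_cocycle: "w \<in> sphere 0 1 \<Longrightarrow> coord (const_cocycle c) w = c"
  unfolding const_cocycle_def by (simp add: coord_of_coord circle_C1_const)

lemma inj_const_cocycle: "inj const_cocycle"
  using coord_const_cocycle[of 1] by (intro injI) (metis mem_sphere_0 norm_one)

text \<open>The map from \<open>c\<close> to the embedded constant is Lipschitz with constant
  1.\<close>

lemma continuous_map_const_cocycle: "continuous_map euclidean X const_cocycle"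
proof (rule continuous_map_into_X)
  have "dist (emb (const_cocycle c)) (emb (const_cocycle d)) \<le> dist c d" for c d
    by (subst dist_emb_le_iff) (simp_all add: const_cocycle_in_E coord_const_cocycle dist_norm)
  then have "continuous_on UNIV (\<lambda>c. emb (const_cocycle c))"
    by (intro continuous_onI) (meson less_imp_le order_trans)
  then show "continuous_map euclidean euclidean (\<lambda>c. emb (const_cocycle c))"
    by simp
qed (rule const_cocycle_in_E)

lemma measurable_const_cocycle: "const_cocycle \<in> lborel \<rightarrow>\<^sub>M borel_of X"
  unfolding borel_of_def
proof (rule measurable_measure_of)
  show "{U. openin X U} \<subseteq> Pow (topspace X)" by (blast dest: openin_subset)
  show "const_cocycle \<in> space lborel \<rightarrow> topspace X" by (simp only: topspace_X) (simp add: const_cocycle_in_E)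
  fix U assume "U \<in> {U. openin X U}"
  then have "open (const_cocycle -` U)"
    using continuous_map_const_cocycle
    by (auto simp: continuous_map vimage_def)
  then show "const_cocycle -` U \<inter> space lborel \<in> sets lborel" by simp
qed

text \<open>The constant \<open>c\<close> misses \<open>nonzero_shift S\<close> exactly when
  \<open>c\<close> is a value of \<open>coord S\<close>. These values are traced by a differentiable
  curve, which has zero area.\<close>

lemma const_cocycle_AE_nonzero_shift:
  assumes "S \<in> E"
  shows "E - nonzero_shift S \<in> null_sets (distr lborel (borel_of X) const_cocycle)"
proof -
  have meas: "E - nonzero_shift S \<in> sets (borel_of X)"
    using sets.compl_sets[OF openin_in_borel_of[OF openin_nonzero_shift[OF assms]]]
    by (simp only: space_borel_of topspace_X)
  have eq: "const_cocycle -` (E - nonzero_shift S) = range (\<lambda>t. coord S (cis t))"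
  proof -
    have "sphere 0 1 = range cis"
      using sphere_eq_cis by (auto simp del: mem_sphere_0) (auto simp: norm_cis)
    then have "range (\<lambda>t. coord S (cis t)) = coord S ` sphere 0 1"
      by (simp add: image_image)
    also have "\<dots> = const_cocycle -` (E - nonzero_shift S)"
      by (force simp: nonzero_shift_def const_cocycle_in_E coord_const_cocycle)
    finally show ?thesis ..
  qed
  have "(\<lambda>t. coord S (cis t)) differentiable_on UNIV"
    using circle_C1_coord[OF assms]
    by (auto simp: circle_C1_def C1_differentiable_on_eq differentiable_on_def)
  then have "negligible (range (\<lambda>t. coord S (cis t)))"
    \<comment> \<open>The parameter line has real dimension 1 and the plane has dimension 2.\<close>
    by (intro negligible_differentiable_image_lowdim) simp_all
  then have "const_cocycle -` (E - nonzero_shift S) \<in> null_sets lebesgue"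
    by (simp add: eq negligible_iff_null_sets)
  \<comment> \<open>Negligibility concerns the completed measure; for a Borel set the null property
    passes to \<open>lborel\<close>.\<close>
  moreover have "const_cocycle -` (E - nonzero_shift S) \<in> sets lborel"
    using measurable_sets[OF measurable_const_cocycle meas] by simp
  ultimately have "emeasure lborel (const_cocycle -` (E - nonzero_shift S)) = 0"
    by (simp add: null_sets_def)
  then show ?thesis
    using meas by (simp add: null_sets_def emeasure_distr[OF measurable_const_cocycle])
qed

text \<open>The witness measure is the push-forward of planar Lebesgue measure to the constants, and
  the compact set is the image of the closed unit disc.\<close>

lemma prevalent_borel_nonzero_shift:
  "prevalent_borel X (cocycle_add P) (nonzero_shift (of_coord (\<lambda>w. 0)))"
  unfolding prevalent_borel_def
proof (intro conjI exI ballI)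
  let ?\<mu> = "distr lborel (borel_of X) const_cocycle"
  let ?V = "const_cocycle ` cball 0 1"
  show "nonzero_shift (of_coord (\<lambda>w. 0)) \<in> sets (borel_of X)"
    by (intro openin_in_borel_of openin_nonzero_shift of_coord_in_E circle_C1_const)
  show "sets ?\<mu> = sets (borel_of X)" by simp
  show V: "compactin X ?V"
    by (rule image_compactin[OF _ continuous_map_const_cocycle]) simp
  \<comment> \<open>Compact sets are closed in the Hausdorff space \<open>X\<close>, which makes the
    measure of \<open>?V\<close> computable as that of its preimage.\<close>
  then have "?V \<in> sets (borel_of X)"
    by (intro closedin_in_borel_of compactin_imp_closedin metrizable_imp_Hausdorff_space
        metrizable_X)
  \<comment> \<open>By injectivity the preimage of \<open>?V\<close> is the disc itself, so its mass
    is the area of the disc.\<close>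
  then have "emeasure ?\<mu> ?V = emeasure lborel (cball 0 1 :: complex set)"
    by (simp add: emeasure_distr[OF measurable_const_cocycle] inj_vimage_image_eq
        inj_const_cocycle)
  moreover have "emeasure lborel (cball 0 1 :: complex set) < \<infinity>"
    by (intro emeasure_bounded_finite) simp
  moreover have "0 < emeasure lborel (cball 0 1 :: complex set)"
  proof -
    have "0 < emeasure lborel (ball 0 1 :: complex set)"
      by (simp add: emeasure_ball)
    also have "\<dots> \<le> emeasure lborel (cball 0 1 :: complex set)"
      by (intro emeasure_mono ball_subset_cball) simp
    finally show ?thesis .
  qed
  ultimately show "0 < emeasure ?\<mu> ?V" "emeasure ?\<mu> ?V < \<infinity>" by simp_all
  fix S assume "S \<in> topspace X"
  then have "S \<in> E" by (simp only: topspace_X)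
  then show "topspace X - (\<lambda>T. cocycle_add P T S) ` nonzero_shift (of_coord (\<lambda>w. 0)) \<in> null_sets ?\<mu>"
    by (simp only: topspace_X translate_nonzero_shift const_cocycle_AE_nonzero_shift)
qed

lemma prevalent_stable:
  "prevalent X (cocycle_add P) (cocycle_scale P) {T \<in> E. stable_cocycle P T}"
  unfolding prevalent_def
proof (intro conjI exI)
  show "nonzero_shift (of_coord (\<lambda>w. 0)) \<subseteq> {T \<in> E. stable_cocycle P T}"
    by (auto simp: nonzero_shift_def coord_of_coord circle_C1_const intro!: stable_if_nonzero)
qed (use metrizable_tvs_X prevalent_borel_nonzero_shift topspace_X in auto)

end

theorem theorem5p15:
  fixes P :: "complex measure" and \<sigma> :: "complex \<Rightarrow> complex"
  assumes "invertible_ergodic_mpt P \<sigma>"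
    and "space P = sphere 0 1"
    and "sets (restrict_space borel (sphere 0 1)) \<subseteq> sets P"
    and "full_support P"
  shows "prevalent (subtopology (cocycle_topology P) (C1_cocycles P))
           (cocycle_add P) (cocycle_scale P) {T \<in> C1_cocycles P. stable_cocycle P T}"
proof -
  interpret circle_base P
    using assms(2-4) by unfold_locales
  show ?thesis by (rule prevalent_stable)
qed

end
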